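(* Let $\mathcal O$ be a non-degenerate conic of $\mathrm{PG}(2,q^2)$, and $[\mathcal O]=\mathcal Q_\infty\cap\mathcal Q_0$ in $\mathrm{PG}(4,q)$, $[\mathcal O]^\star=\mathcal Q_\infty^\star\cap\mathcal Q_0^\star$ in $\mathrm{PG}(4,q^2)$, $[\mathcal O]^{\star\star}=\mathcal Q_\infty^{\star\star}\cap\mathcal Q_0^{\star\star}$ in $\mathrm{PG}(4,q^4)$. (1) If $\mathcal O\cap\ell_\infty=\{\bar P,\bar Q\}$ with $\bar P\ne\bar Q$, then $[\mathcal O]\cap\Sigma_\infty=[P]\cup[Q]$; $[\mathcal O]^\star\cap\Sigma_\infty^\star=[P]^\star\cup[Q]^\star\cup PQ^q\cup P^qQ$; and $[\mathcal O]^{\star\star}\cap\Sigma_\infty^{\star\star}=[P]^{\star\star}\cup[Q]^{\star\star}\cup(PQ^q)^{\star\star}\cup(P^qQ)^{\star\star}$. (2) If $\mathcal O\cap\ell_\infty=\{\bar P\}$ ($\ell_\infty$ tangent), then $[\mathcal O]\cap\Sigma_\infty=[P]$, $[\mathcal O]^\star\cap\Sigma_\infty^\star=[P]^\star$ and $[\mathcal O]^{\star\star}\cap\Sigma_\infty^{\star\star}=[P]^{\star\star}$. (3) If $\mathcal O\cap\ell_\infty=\emptyset$, so that the extensions of $\mathcal O$ and $\ell_\infty$ to $\mathrm{PG}(2,q^4)$ meet in two points $\bar P,\bar P^{q^2}$, then $[\mathcal O]\cap\Sigma_\infty=\emptyset$, $[\mathcal O]^\star\cap\Sigma_\infty^\star=\emptyset$,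 and $[\mathcal O]^{\star\star}\cap\Sigma_\infty^{\star\star}=\ell_P\cup\ell_P^q\cup\ell_P^{q^2}\cup\ell_P^{q^3}$, where $\ell_P=PP^q$.
   Context: Coordinates: $q$ a prime power; $\tau$ is a primitive element of $\mathbb F_{q^2}$ with minimal polynomial $x^2-t_1x-t_0$ over $\mathbb F_q$. $\mathrm{PG}(2,q^2)$ has coordinates $(x,y,z)$, $\ell_\infty: z=0$; $\mathrm{PG}(4,q)$ has coordinates $(x_0,x_1,y_0,y_1,z)$ and $\Sigma_\infty: z=0$. The Bruck–Bose map sends the affine point $(x_0+x_1\tau,y_0+y_1\tau,z)$ ($x_i,y_i,z\in\mathbb F_q$, $z\ne0$) to $(x_0,x_1,y_0,y_1,z)$, and $\bar T=(\delta,1,0)\in\ell_\infty$, $\delta=d_0+d_1\tau$, to the spread line $[T]=\langle(d_0,d_1,1,0,0),(t_0d_1,d_0+t_1d_1,0,1,0)\rangle$ (and $(1,0,0)$ to $\langle(1,0,0,0,0),(0,1,0,0,0)\rangle$); these form a regular spread $\mathcal S$ of $\Sigma_\infty$. With $A_0=(\tau^q,-1,0,0,0)$, $A_1=(0,0,\tau^q,-1,0)$, the transversals of $\mathcal S$ in $\mathrm{PG}(4,q^2)$ are $g=\langle A_0,A_1\rangle$, $g^q=\langle A_0^q,A_1^q\rangle$, where $X\mapsto X^q$ raises coordinates to the $q$-th power. For $\alpha\in\mathbb F_{q^4}\cup\{\infty\}$ the point $\bar P=(\alpha,1,0)$ of (the extension to $\mathrm{PG}(2,q^4)$ of) $\ell_\infty$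 corresponds to $P=\alpha A_0+A_1$ ($P=A_0$ if $\alpha=\infty$) on the extension of $g$; for $\bar P\in\ell_\infty$ one has $[P]^\star=PP^q$. If $\mathcal O$ has equation $f(x,y,z)=0$ over $\mathbb F_{q^2}$, substituting $x=x_0+x_1\tau$, $y=y_0+y_1\tau$ and reducing with $\tau^2=t_1\tau+t_0$ gives $f=f_\infty+\tau f_0$ with $f_\infty,f_0$ homogeneous quadratics over $\mathbb F_q$ in $(x_0,x_1,y_0,y_1,z)$; $\mathcal Q_\infty,\mathcal Q_0$ are the quadrics $f_\infty=0$, $f_0=0$. For any set $\mathcal V$ defined by equations over $\mathbb F_q$ (quadric, subspace), $\mathcal V^\star$, $\mathcal V^{\star\star}$ are the sets of points of $\mathrm{PG}(4,q^2)$, $\mathrm{PG}(4,q^4)$ satisfying the same equations; for a line $\ell$ of $\mathrm{PG}(4,q^2)$, $\ell^{\star\star}$ is its extension to $\mathrm{PG}(4,q^4)$. *)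

theory Defs
  imports "HOL-Computational_Algebra.Primes"
begin

text \<open>Everything lives inside one finite field K = 'a with |K| = q^4, i.e. K = F_{q^4}.
  The subfield F_r (r = q, q^2, q^4) is the set of fixed points of x \<mapsto> x^r.
  Vectors of PG(n,-) are functions nat \<Rightarrow> 'a that vanish outside the index range;
  a point set of PG(4,r) is represented by the set of ALL its nonzero representative
  vectors with coordinates in F_r (so equality of point sets = equality of these sets).\<close>

definition subF :: "nat \<Rightarrow> 'a::field set" where
  "subF r = {x. x ^ r = x}"

definition vecs :: "nat \<Rightarrow> (nat \<Rightarrow> 'a::field) set" where
  "vecs r = {v. (\<forall>i. v i \<in> subF r) \<and> (\<forall>i\<ge>5. v i = 0) \<and> v \<noteq> (\<lambda>_. 0)}"

definition Sigma_inf :: "nat \<Rightarrow> (nat \<Rightarrow> 'a::field) set" where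
  "Sigma_inf r = {v \<in> vecs r. v 4 = 0}"

definition sp2 :: "(nat \<Rightarrow> 'a::field) \<Rightarrow> (nat \<Rightarrow> 'a) \<Rightarrow> (nat \<Rightarrow> 'a) set" where
  "sp2 u w = {v. \<exists>a b. v = (\<lambda>i. a * u i + b * w i)}"

text \<open>points of PG(4,r) on the line spanned by u, w (u, w with coordinates in F_r, or the
  extension to PG(4,q^4) when r = q^4)\<close>
definition line_pts :: "nat \<Rightarrow> (nat \<Rightarrow> 'a::field) \<Rightarrow> (nat \<Rightarrow> 'a) \<Rightarrow> (nat \<Rightarrow> 'a) set" where
  "line_pts r u w = vecs r \<inter> sp2 u w"

definition frobv :: "nat \<Rightarrow> (nat \<Rightarrow> 'a::field) \<Rightarrow> (nat \<Rightarrow> 'a)" where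
  "frobv r v = (\<lambda>i. v i ^ r)"

definition decomp :: "nat \<Rightarrow> 'a::field \<Rightarrow> 'a \<Rightarrow> 'a \<times> 'a" where
  "decomp q tau z = (THE (a, b). a \<in> subF q \<and> b \<in> subF q \<and> z = a + b * tau)"

definition Q3 :: "(nat \<Rightarrow> nat \<Rightarrow> 'a::field) \<Rightarrow> (nat \<Rightarrow> 'a) \<Rightarrow> 'a" where
  "Q3 c x = (\<Sum>i<3. \<Sum>j\<in>{i..<3}. c i j * x i * x j)"

definition dQ3 :: "(nat \<Rightarrow> nat \<Rightarrow> 'a::field) \<Rightarrow> nat \<Rightarrow> (nat \<Rightarrow> 'a) \<Rightarrow> 'a" where
  "dQ3 c k x = (\<Sum>i<3. \<Sum>j\<in>{i..<3}.
      c i j * ((if i = k then x j else 0) + (if j = k then x i else 0)))"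

text \<open>non-degenerate conic: no singular point (point of the conic where all partial
  derivatives vanish), with coordinates in K = F_{q^4} (an extension of F_{q^2})\<close>
definition nondeg_conic :: "(nat \<Rightarrow> nat \<Rightarrow> 'a::field) \<Rightarrow> bool" where
  "nondeg_conic c \<longleftrightarrow> \<not> (\<exists>x. (\<forall>i\<ge>3. x i = 0) \<and> x \<noteq> (\<lambda>_. 0) \<and> Q3 c x = 0 \<and>
                               (\<forall>k<3. dQ3 c k x = 0))"

definition pt3 :: "'a::field \<Rightarrow> 'a \<Rightarrow> (nat \<Rightarrow> 'a)" where
  "pt3 x y = (\<lambda>i. if i = 0 then x else if i = 1 then y else 0)"

text \<open>Bruck-Bose substitution x = x0 + x1 tau, y = y0 + y1 tau, z = z as a 3x5 matrix\<close>
definition bbm :: "'a::field \<Rightarrow> nat \<Rightarrow> nat \<Rightarrow> 'a" where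
  "bbm tau i k = (if i = 0 \<and> k = 0 then 1 else if i = 0 \<and> k = 1 then tau
                 else if i = 1 \<and> k = 2 then 1 else if i = 1 \<and> k = 3 then tau
                 else if i = 2 \<and> k = 4 then 1 else 0)"

text \<open>coefficient (in F_{q^2}) of the monomial x_k x_l (k \<le> l) of f after substitution\<close>
definition bbcoef :: "'a::field \<Rightarrow> (nat \<Rightarrow> nat \<Rightarrow> 'a) \<Rightarrow> nat \<Rightarrow> nat \<Rightarrow> 'a" where
  "bbcoef tau c k l = (\<Sum>i<3. \<Sum>j\<in>{i..<3}. c i j *
      (if k = l then bbm tau i k * bbm tau j k
       else bbm tau i k * bbm tau j l + bbm tau i l * bbm tau j k))"

text \<open>f = f_infty + tau f_0 : the two quadratic forms over F_q in (x0,x1,y0,y1,z)\<close>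
definition f_inf :: "nat \<Rightarrow> 'a::field \<Rightarrow> (nat \<Rightarrow> nat \<Rightarrow> 'a) \<Rightarrow> (nat \<Rightarrow> 'a) \<Rightarrow> 'a" where
  "f_inf q tau c v = (\<Sum>k<5. \<Sum>l\<in>{k..<5}. fst (decomp q tau (bbcoef tau c k l)) * v k * v l)"

definition f_0 :: "nat \<Rightarrow> 'a::field \<Rightarrow> (nat \<Rightarrow> nat \<Rightarrow> 'a) \<Rightarrow> (nat \<Rightarrow> 'a) \<Rightarrow> 'a" where
  "f_0 q tau c v = (\<Sum>k<5. \<Sum>l\<in>{k..<5}. snd (decomp q tau (bbcoef tau c k l)) * v k * v l)"

definition bbO :: "nat \<Rightarrow> nat \<Rightarrow> 'a::field \<Rightarrow> (nat \<Rightarrow> nat \<Rightarrow> 'a) \<Rightarrow> (nat \<Rightarrow> 'a) set" where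
  "bbO r q tau c = {v \<in> vecs r. f_inf q tau c v = 0 \<and> f_0 q tau c v = 0}"

text \<open>transversal points A_0, A_1 and the image P = x A_0 + y A_1 of (x, y, 0)\<close>
definition A0 :: "nat \<Rightarrow> 'a::field \<Rightarrow> (nat \<Rightarrow> 'a)" where
  "A0 q tau = (\<lambda>i. if i = 0 then tau ^ q else if i = 1 then -1 else 0)"

definition A1 :: "nat \<Rightarrow> 'a::field \<Rightarrow> (nat \<Rightarrow> 'a)" where
  "A1 q tau = (\<lambda>i. if i = 2 then tau ^ q else if i = 3 then -1 else 0)"

definition embP :: "nat \<Rightarrow> 'a::field \<Rightarrow> 'a \<Rightarrow> 'a \<Rightarrow> (nat \<Rightarrow> 'a)" where
  "embP q tau x y = (\<lambda>i. x * A0 q tau i + y * A1 q tau i)"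

text \<open>the two generators of the spread line [T] for T = (x, y, 0) \<in> l_infty;
  (delta,1,0) with delta = d0 + d1 tau, or (1,0,0)\<close>
definition spread_gens :: "nat \<Rightarrow> 'a::field \<Rightarrow> 'a \<Rightarrow> 'a \<Rightarrow> 'a \<Rightarrow> 'a
      \<Rightarrow> (nat \<Rightarrow> 'a) \<times> (nat \<Rightarrow> 'a)" where
  "spread_gens q tau t0 t1 x y =
     (if y = 0 then ((\<lambda>i. if i = 0 then 1 else 0), (\<lambda>i. if i = 1 then 1 else 0))
      else (let (d0, d1) = decomp q tau (x / y) in
        ((\<lambda>i. if i = 0 then d0 else if i = 1 then d1 else if i = 2 then 1 else 0),
         (\<lambda>i. if i = 0 then t0 * d1 else if i = 1 then d0 + t1 * d1
              else if i = 3 then 1 else 0))))"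

definition spread_line :: "nat \<Rightarrow> nat \<Rightarrow> 'a::field \<Rightarrow> 'a \<Rightarrow> 'a \<Rightarrow> 'a \<Rightarrow> 'a \<Rightarrow> (nat \<Rightarrow> 'a) set" where
  "spread_line r q tau t0 t1 x y =
     (let (g, h) = spread_gens q tau t0 t1 x y in line_pts r g h)"

end

theory Submission
  imports Defs "HOL-Algebra.Algebraic_Closure_Type"
begin

text \<open>
  Write \<open>X = x\<^sub>0 + x\<^sub>1 \<tau>\<close>, \<open>Y = y\<^sub>0 + y\<^sub>1 \<tau>\<close> and let \<open>X'\<close>, \<open>Y'\<close> be the same expressions with \<open>\<tau>\<^sup>q\<close> in
  place of \<open>\<tau>\<close>; these are linear coordinates of \<open>\<Sigma>\<^sub>\<infinity>\<close> over any field containing \<open>\<tau>\<close>. If \<open>g\<close> is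
  the restriction of the conic to the line at infinity and \<open>g'\<close> is obtained from \<open>g\<close> by raising the
  coefficients to the \<open>q\<close>-th power, then \<open>f\<^sub>\<infinity> + \<tau> f\<^sub>0 = g(X, Y)\<close> and \<open>f\<^sub>\<infinity> + \<tau>\<^sup>q f\<^sub>0 = g'(X', Y')\<close>, so
  both quadrics vanish iff \<open>(X, Y)\<close> is a root of \<open>g\<close> and \<open>(X', Y')\<close> is the \<open>q\<close>-th power of one.
  The points with \<open>(X, Y)\<close> proportional to \<open>P\<close> and \<open>(X', Y')\<close> proportional to \<open>S\<^sup>q\<close> form the line
  \<open>P S\<^sup>q\<close>, which is the spread line \<open>[P]\<close> if \<open>P = S\<close>. Hence the lines in question correspond to
  the pairs of roots of \<open>g\<close>.
\<close>

section \<open>Finite fields: power maps, characteristic and roots of quadratics\<close>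

hide_const (open) Divisibility.prime

text \<open>
  The library version requires the class \<open>finite_field\<close>, which is not implied by the sort
  \<open>{field,finite}\<close>.
\<close>
lemma finite_field_power_card:
  fixes x :: "'a::{field,finite}"
  shows "x ^ card (UNIV :: 'a set) = x"
proof (cases "x = 0")
  case True
  then show ?thesis by (simp add: finite_UNIV_card_ge_0)
next
  case False
  let ?U = "UNIV - {0 :: 'a}"
  have "bij_betw ((*) x) ?U ?U"
    by (rule bij_betw_byWitness[where f' = "\<lambda>y. y / x"]) (use False in auto)
  then have "(\<Prod>y\<in>?U. y) = (\<Prod>y\<in>?U. x * y)"
    by (simp add: prod.reindex_bij_betw[where g = "\<lambda>y. y"])
  also have "\<dots> = x ^ card ?U * (\<Prod>y\<in>?U. y)"
    by (simp add: prod.distrib)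
  finally have "x ^ card ?U = 1"
    by simp
  then have "x ^ Suc (card ?U) = x"
    by simp
  also have "Suc (card ?U) = card (UNIV :: 'a set)"
    by (rule card_Suc_Diff1) auto
  finally show ?thesis .
qed

text \<open>Translation by 1 permutes the field, so summing \<open>x + 1\<close> over all
  \<open>x\<close> gives \<open>p ^ n = 0\<close> in the field; the characteristic is then a prime
  divisor of \<open>p ^ n\<close>.\<close>

lemma CHAR_eq_of_card_prime_power:
  assumes "prime p" "card (UNIV :: 'a::{field,finite} set) = p ^ n"
  shows "CHAR('a) = p"
proof -
  have "prime CHAR('a)"
    by (rule prime_CHAR_semidom) (simp add: finite_imp_CHAR_pos)
  moreover have "CHAR('a) dvd p ^ n"
  proof -
    have "(\<Sum>x\<in>UNIV. x + 1 :: 'a) = (\<Sum>x\<in>UNIV. x)"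
      by (rule sum.reindex_bij_witness[of _ "\<lambda>x. x - 1" "\<lambda>x. x + 1"]) auto
    then have "of_nat (p ^ n) = (0 :: 'a)"
      by (simp add: sum.distrib flip: assms(2))
    then show ?thesis
      by (simp only: of_nat_eq_0_iff_char_dvd)
  qed
  ultimately show ?thesis
    using assms(1) primes_dvd_imp_eq prime_dvd_power by blast
qed

text \<open>The \<open>N\<close> embedded field elements are already roots of the nonzero polynomial
  \<open>X ^ N - X\<close>, whose degree leaves no room for another.\<close>

lemma in_range_to_ac_if_power_card:
  fixes \<beta> :: "'a::{field,finite} alg_closure"
  assumes "\<beta> ^ card (UNIV :: 'a set) = \<beta>"
  shows "\<beta> \<in> range to_ac"
proof (rule ccontr)
  assume \<beta>: "\<beta> \<notin> range to_ac"
  define N where "N = card (UNIV :: 'a set)"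
  define P :: "'a alg_closure poly" where "P = monom 1 N - monom 1 1"
  have "card {0 :: 'a, 1} \<le> N"
    unfolding N_def by (intro card_mono) auto
  then have "N > 1"
    by simp
  then have "P \<noteq> 0" "degree P \<le> N"
    unfolding P_def by (auto simp: monom_eq_iff' intro!: degree_diff_le order.trans[OF degree_monom_le])
  have "range to_ac \<subseteq> {x. poly P x = 0}"
    by (auto simp: P_def N_def poly_monom finite_field_power_card simp flip: to_ac_power)
  moreover have "poly P \<beta> = 0"
    using assms by (simp add: P_def N_def poly_monom)
  ultimately have "insert \<beta> (range to_ac) \<subseteq> {x. poly P x = 0}"
    by auto
  then have "card (insert \<beta> (range (to_ac :: 'a \<Rightarrow> _))) \<le> card {x. poly P x = 0}"
    using \<open>P \<noteq> 0\<close> by (intro card_mono poly_roots_finite)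
  also have "\<dots> \<le> N"
    using card_poly_roots_bound[OF \<open>P \<noteq> 0\<close>] \<open>degree P \<le> N\<close> by simp
  also have "card (insert \<beta> (range (to_ac :: 'a \<Rightarrow> _))) = Suc N"
    using \<beta> by (simp add: N_def card_image inj_to_ac)
  finally show False
    by simp
qed

text \<open>
  A root of a monic quadratic over the fixed field of \<open>x \<mapsto> x ^ r\<close> is sent by this map to
  itself or to the other root, so its square fixes all roots in an algebraic closure.
\<close>
lemma quadratic_has_root:
  fixes b c :: "'a::{field,finite}"
  assumes p: "prime p" and r: "r = p ^ n" and card: "card (UNIV :: 'a set) = r ^ 2"
    and b: "b ^ r = b" and c: "c ^ r = c"
  shows "\<exists>x. x ^ 2 + b * x + c = 0"
proof -
  have "card (UNIV :: 'a set) = p ^ (n * 2)"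
    by (simp add: card r power_mult)
  then have char: "CHAR('a) = p"
    by (rule CHAR_eq_of_card_prime_power[OF p])
  have add: "(x + y) ^ r = x ^ r + y ^ r" for x y :: "'a alg_closure"
    by (rule freshmans_dream'[where n = n]) (simp_all add: char p r)
  have "\<exists>x. poly [:to_ac c, to_ac b, 1:] x = 0"
    by (rule alg_closed_imp_poly_has_root) simp
  then obtain \<beta> where \<beta>: "\<beta> ^ 2 + to_ac b * \<beta> + to_ac c = 0"
    by (auto simp: power2_eq_square algebra_simps)
  have r0: "r \<noteq> 0"
    using p r by auto
  have "(\<beta> ^ 2 + to_ac b * \<beta> + to_ac c) ^ r = 0"
    unfolding \<beta> using r0 by simp
  then have \<beta>r: "(\<beta> ^ r) ^ 2 + to_ac b * \<beta> ^ r + to_ac c = 0"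
    by (simp add: add power_mult_distrib b c flip: to_ac_power) (simp add: mult.commute flip: power_mult)
  have "(\<beta> ^ r - \<beta>) * (\<beta> ^ r + \<beta> + to_ac b)
      = ((\<beta> ^ r) ^ 2 + to_ac b * \<beta> ^ r + to_ac c) - (\<beta> ^ 2 + to_ac b * \<beta> + to_ac c)"
    by (simp add: power2_eq_square algebra_simps)
  then have "(\<beta> ^ r - \<beta>) * (\<beta> ^ r + \<beta> + to_ac b) = 0"
    using \<beta> \<beta>r by simp
  then consider "\<beta> ^ r = \<beta>" | "\<beta> ^ r + \<beta> + to_ac b = 0"
    by auto
  then have "(\<beta> ^ r) ^ r = \<beta>"
  proof cases
    case 2
    then have "(\<beta> ^ r + \<beta> + to_ac b) ^ r = 0"
      using r0 by simp
    then have "(\<beta> ^ r) ^ r + \<beta> ^ r + to_ac b = 0"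
      by (simp add: add b flip: to_ac_power)
    with 2 have "(\<beta> ^ r) ^ r + \<beta> ^ r + to_ac b = \<beta> + \<beta> ^ r + to_ac b"
      by (simp add: add.commute)
    then show ?thesis
      by simp
  qed simp
  then have "\<beta> ^ card (UNIV :: 'a set) = \<beta>"
    by (simp add: card power2_eq_square power_mult)
  then obtain x where "\<beta> = to_ac x"
    using in_range_to_ac_if_power_card by blast
  with \<beta> have "to_ac (x ^ 2 + b * x + c) = 0"
    by simp
  then show ?thesis
    by (auto simp only: to_ac_eq_0_iff)
qed

section \<open>Binary quadratic forms on the line at infinity\<close>

lemma Q3_pt3: "Q3 c (pt3 x y) = c 0 0 * x ^ 2 + c 0 1 * x * y + c 1 1 * y ^ 2"
proof -
  have "{0..<3} = {0, 1, 2 :: nat}" "{Suc 0..<3} = {1, 2}" "{2..<3} = {2 :: nat}" "{..<3} = {0, 1, 2 :: nat}"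
    by auto
  then show ?thesis
    by (simp add: Q3_def pt3_def power2_eq_square algebra_simps)
qed

text \<open>The parameter \<open>t\<close> is free because both \<open>tau\<close> and its conjugate
  \<open>tau ^ q\<close> are inserted later.\<close>

lemma sum_bbcoef_at_infinity:
  assumes "v 4 = 0"
  shows "(\<Sum>k<5. \<Sum>l\<in>{k..<5}. bbcoef t c k l * v k * v l)
           = Q3 c (pt3 (v 0 + v 1 * t) (v 2 + v 3 * t))"
proof -
  have "{0..<3} = {0, 1, 2 :: nat}" "{Suc 0..<3} = {1, 2}" "{2..<3} = {2 :: nat}" "{..<3} = {0, 1, 2 :: nat}"
    "{0..<5} = {0, 1, 2, 3, 4 :: nat}" "{Suc 0..<5} = {1, 2, 3, 4}" "{2..<5} = {2, 3, 4 :: nat}"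
    "{3..<5} = {3, 4 :: nat}" "{4..<5} = {4 :: nat}" "{..<5} = {0, 1, 2, 3, 4 :: nat}"
    by auto
  then show ?thesis
    by (simp add: assms Q3_pt3 bbcoef_def bbm_def power2_eq_square algebra_simps)
qed

lemma proportional_imp_multiple:
  fixes x y p1 p2 :: "'a::field"
  assumes "x * p2 = y * p1" "(p1, p2) \<noteq> (0, 0)"
  obtains a where "x = a * p1" "y = a * p2"
proof (cases "p2 = 0")
  case True
  then have "x = x / p1 * p1" "y = x / p1 * p2"
    using assms by auto
  then show ?thesis by (rule that)
next
  case False
  then have "x = y / p2 * p1" "y = y / p2 * p2"
    using assms by (auto simp: field_simps)
  then show ?thesis by (rule that)
qed

text \<open>Cramer's rule for a homogeneous system.\<close>

lemma proportional_to_both_imp_zero: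
  fixes x y p1 p2 :: "'a::field"
  assumes "x * p2 = y * p1" "x * s2 = y * s1" "p1 * s2 \<noteq> p2 * s1"
  shows "x = 0 \<and> y = 0"
proof -
  have "x * (p1 * s2 - p2 * s1) = p1 * (x * s2 - y * s1) - s1 * (x * p2 - y * p1)"
    "y * (p1 * s2 - p2 * s1) = p2 * (x * s2 - y * s1) - s2 * (x * p2 - y * p1)"
    by (simp_all add: algebra_simps)
  then have "x * (p1 * s2 - p2 * s1) = 0" "y * (p1 * s2 - p2 * s1) = 0"
    by (simp_all only: assms(1,2) diff_self mult_zero_right)
  then show ?thesis
    using assms(3) by simp
qed

text \<open>In the basis \<open>p\<close>, \<open>s\<close> the square terms vanish, because both
  vectors are roots, and only a multiple of the product of the two linear forms is left. The value
  at \<open>w\<close> shows that this multiple is nonzero.\<close>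

lemma binary_form_split:
  fixes c :: "nat \<Rightarrow> nat \<Rightarrow> 'a::field"
  assumes p: "Q3 c (pt3 p1 p2) = 0" and s: "Q3 c (pt3 s1 s2) = 0" and ps: "p1 * s2 \<noteq> p2 * s1"
    and nz: "Q3 c (pt3 w1 w2) \<noteq> 0"
  shows "Q3 c (pt3 x y) = 0 \<longleftrightarrow> x * p2 = y * p1 \<or> x * s2 = y * s1"
proof -
  \<comment> \<open>Minus the polar form at \<open>p\<close> and \<open>s\<close>; it arises from
    \<open>d * (x, y) = (x * s2 - y * s1) * p - (x * p2 - y * p1) * s\<close>.\<close>
  define m where "m = - (2 * c 0 0 * p1 * s1 + c 0 1 * (p1 * s2 + p2 * s1) + 2 * c 1 1 * p2 * s2)"
  define d where "d = p1 * s2 - p2 * s1"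
  have fac: "d ^ 2 * Q3 c (pt3 x y) = m * ((x * p2 - y * p1) * (x * s2 - y * s1))" for x y
  proof -
    have "d ^ 2 * Q3 c (pt3 x y) = (x * s2 - y * s1) ^ 2 * Q3 c (pt3 p1 p2)
        + (x * p2 - y * p1) ^ 2 * Q3 c (pt3 s1 s2) + m * ((x * p2 - y * p1) * (x * s2 - y * s1))"
      unfolding Q3_pt3 m_def d_def by (simp add: power2_eq_square algebra_simps)
    with p s show ?thesis
      by simp
  qed
  have "d \<noteq> 0"
    using ps by (simp add: d_def)
  moreover have "m \<noteq> 0"
    using fac[of w1 w2] nz \<open>d \<noteq> 0\<close> by auto
  ultimately show ?thesis
    using fac[of x y] by auto
qed

text \<open>At \<open>t = tau\<close> this is the coordinate X of the overview, at
  \<open>t = tau ^ q\<close> it is X'; likewise \<open>aff_y\<close>.\<close>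

definition aff_x :: "'a::field \<Rightarrow> (nat \<Rightarrow> 'a) \<Rightarrow> 'a" where
  "aff_x t v = v 0 + v 1 * t"

definition aff_y :: "'a::field \<Rightarrow> (nat \<Rightarrow> 'a) \<Rightarrow> 'a" where
  "aff_y t v = v 2 + v 3 * t"

lemma line_pts_commute: "line_pts r u w = line_pts r w u"
proof -
  have "sp2 u w \<subseteq> sp2 w u" for u w :: "nat \<Rightarrow> 'a"
    unfolding sp2_def by clarify (metis add.commute)
  then show ?thesis
    unfolding line_pts_def by blast
qed

section \<open>Frobenius powers and subfields of the field with \<open>q ^ 4\<close>
  elements\<close>

locale bruck_bose =
  fixes q :: nat and tau t0 t1 :: "'a::{field,finite}"
  assumes q_prime_power: "\<exists>p k. prime p \<and> k > 0 \<and> q = p ^ k"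
    and card_UNIV: "card (UNIV :: 'a set) = q ^ 4"
    and tau_in: "tau \<in> subF (q ^ 2)" and tau_nonzero: "tau \<noteq> 0"
    and tau_primitive: "\<forall>k. 0 < k \<and> k < q ^ 2 - 1 \<longrightarrow> tau ^ k \<noteq> 1"
    and t0_in: "t0 \<in> subF q" and t1_in: "t1 \<in> subF q"
    and minpoly: "tau ^ 2 = t1 * tau + t0"
begin

lemma q_ge_2: "q \<ge> 2"
proof -
  obtain p k where p: "prime p" "k > 0" "q = p ^ k"
    using q_prime_power by blast
  then have "p \<le> q"
    by (simp add: self_le_power prime_gt_0_nat Suc_leI)
  with prime_ge_2_nat[OF p(1)] show ?thesis
    by simp
qed

lemma q_pos [simp]: "q > 0"
  using q_ge_2 by simp

lemma frob_add: "(x + y :: 'a) ^ (q ^ m) = x ^ (q ^ m) + y ^ (q ^ m)"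
proof -
  obtain p k where p: "prime p" "q = p ^ k"
    using q_prime_power by blast
  have "CHAR('a) = p"
    by (rule CHAR_eq_of_card_prime_power[OF p(1), where n = "k * 4"]) (simp add: card_UNIV p(2) power_mult)
  then show ?thesis
    by (intro freshmans_dream'[where n = "k * m"]) (simp_all add: p power_mult)
qed

lemma frob_minus: "(- x :: 'a) ^ (q ^ m) = - (x ^ (q ^ m))"
proof -
  have "(x + - x) ^ (q ^ m) = 0"
    by (simp add: power_0_left)
  then have "x ^ (q ^ m) + (- x) ^ (q ^ m) = 0"
    by (simp only: frob_add)
  then show ?thesis
    by (simp add: eq_neg_iff_add_eq_0 add.commute)
qed

lemma frob_diff: "(x - y :: 'a) ^ (q ^ m) = x ^ (q ^ m) - y ^ (q ^ m)"
  using frob_add[of x "- y" m] frob_minus[of y m] by simp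

lemma frob_sum: "sum f A ^ (q ^ m) = (\<Sum>i\<in>A. (f i :: 'a) ^ (q ^ m))"
  by (induction A rule: infinite_finite_induct) (simp_all add: frob_add power_0_left)

lemmas frob_add_q = frob_add[of _ _ 1, simplified]
lemmas frob_minus_q = frob_minus[of _ 1, simplified]
lemmas frob_diff_q = frob_diff[of _ _ 1, simplified]

lemma frob_frob: "((x :: 'a) ^ (q ^ m)) ^ (q ^ n) = x ^ (q ^ (m + n))"
  by (simp add: power_add flip: power_mult)

lemma frob_4: "(x :: 'a) ^ (q ^ 4) = x"
  using finite_field_power_card[of x] by (simp add: card_UNIV)

lemma frob_3_q: "((x :: 'a) ^ (q ^ 3)) ^ q = x"
  using frob_frob[of x 3 1] frob_4[of x] by simp

lemma frob_q_3: "((x :: 'a) ^ q) ^ (q ^ 3) = x"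
  using frob_frob[of x 1 3] frob_4[of x] by simp

lemma subF_iff: "(x :: 'a) \<in> subF r \<longleftrightarrow> x ^ r = x"
  by (simp add: subF_def)

lemma subF_closed:
  assumes "x \<in> subF (q ^ m)" "y \<in> subF (q ^ m)"
  shows "(x + y :: 'a) \<in> subF (q ^ m)" "x - y \<in> subF (q ^ m)"
    "x * y \<in> subF (q ^ m)" "x / y \<in> subF (q ^ m)"
  using assms by (auto simp: subF_iff frob_add frob_diff power_mult_distrib power_divide)

lemma subF_minus: "x \<in> subF (q ^ m) \<Longrightarrow> (- x :: 'a) \<in> subF (q ^ m)"
  by (simp add: subF_iff frob_minus)

lemma subF_power: "x \<in> subF (q ^ m) \<Longrightarrow> (x :: 'a) ^ n \<in> subF (q ^ m)"
  unfolding subF_iff by (metis mult.commute power_mult)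

lemma zero_one_in_subF: "(0 :: 'a) \<in> subF (q ^ m)" "(1 :: 'a) \<in> subF (q ^ m)"
  by (simp_all add: subF_iff power_0_left)

section \<open>Conjugation of \<open>tau\<close> and coordinates in the basis 1,
  \<open>tau\<close>\<close>

lemma tau_q_q: "(tau ^ q) ^ q = tau"
  using tau_in by (simp add: subF_iff power2_eq_square power_mult)

lemma tau_q_in: "tau ^ q \<in> subF (q ^ 2)"
  using tau_q_q by (simp add: subF_iff power2_eq_square power_mult)

lemma tau_q_3: "(tau ^ q) ^ (q ^ 3) = tau"
  by (rule frob_q_3)

text \<open>Equality would give \<open>tau ^ (q - 1) = 1\<close>, too small an exponent for a
  primitive element.\<close>

lemma tau_neq: "tau \<noteq> tau ^ q"
proof
  assume "tau = tau ^ q"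
  also have "tau ^ q = tau * tau ^ (q - 1)"
    using q_pos by (simp flip: power_Suc)
  finally have "tau ^ (q - 1) = 1"
    using tau_nonzero by simp
  moreover have "0 < q - 1" "q - 1 < q ^ 2 - 1"
    using q_ge_2 power_strict_increasing[of 1 2 q] by auto
  ultimately show False
    using tau_primitive by blast
qed

lemma minpoly_conj: "(tau ^ q) ^ 2 = t1 * tau ^ q + t0"
proof -
  have "(tau ^ 2) ^ q = (t1 * tau + t0) ^ q"
    by (simp add: minpoly)
  then show ?thesis
    using t0_in t1_in by (simp add: frob_add_q power_mult_distrib subF_iff) (metis mult.commute power_mult)
qed

text \<open>The coefficients range over the whole field, so it takes both equations to determine
  them; the system has determinant \<open>tau ^ q - tau\<close>.\<close>

lemma tau_coords_unique:
  assumes "a + b * tau = a' + b' * tau" "a + b * tau ^ q = a' + b' * tau ^ q"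
  shows "a = a' \<and> b = b'"
proof -
  have "(b - b') * (tau - tau ^ q) = (a + b * tau - (a' + b' * tau)) - (a + b * tau ^ q - (a' + b' * tau ^ q))"
    by (simp add: algebra_simps)
  then have "b = b'"
    using tau_neq assms by simp
  with assms show ?thesis
    by simp
qed

text \<open>\<open>decomp\<close> is a definite description, so existence and uniqueness of the pair
  are both established.\<close>

lemma decomp_spec:
  assumes z: "z \<in> subF (q ^ 2)"
  shows "z = fst (decomp q tau z) + snd (decomp q tau z) * tau"
    and "z ^ q = fst (decomp q tau z) + snd (decomp q tau z) * tau ^ q"
proof -
  let ?P = "\<lambda>(a, b). a \<in> subF q \<and> b \<in> subF q \<and> z = a + b * tau"
  have conj: "z ^ q = a + b * tau ^ q" if "?P (a, b)" for a b
    using that by (auto simp: frob_add_q power_mult_distrib subF_iff)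
  have zqq: "(z ^ q) ^ q = z"
    using z by (simp add: subF_iff power2_eq_square power_mult)
  \<comment> \<open>Cramer's rule for \<open>z = a + b * tau\<close> and its conjugate. Numerator
    and denominator of \<open>b\<close> both change sign under the \<open>q\<close>-th power, so
    \<open>b\<close> is fixed by it.\<close>
  define b where "b = (z - z ^ q) / (tau - tau ^ q)"
  define a where "a = z - b * tau"
  have b_mult: "b * (tau - tau ^ q) = z - z ^ q"
    using tau_neq by (simp add: b_def)
  have "b ^ q = (z ^ q - z) / (tau ^ q - tau)"
    by (simp add: b_def power_divide frob_diff_q zqq tau_q_q)
  also have "\<dots> = b"
    unfolding b_def by (metis minus_diff_eq minus_divide_divide)
  finally have "b ^ q = b" .
  moreover have "a ^ q = a"
    using b_mult by (simp add: a_def frob_diff_q \<open>b ^ q = b\<close> algebra_simps)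
  ultimately have P: "?P (a, b)"
    by (simp add: subF_iff a_def)
  have "decomp q tau z = (a, b)"
    unfolding decomp_def
  proof (rule the_equality)
    show "?P (a, b)"
      by (rule P)
  next
    fix w assume w: "?P w"
    obtain a' b' where [simp]: "w = (a', b')"
      by fastforce
    have "a' = a \<and> b' = b"
      by (rule tau_coords_unique) (use w P conj[OF P] conj[of a' b'] in auto)
    then show "w = (a, b)"
      by simp
  qed
  then show "z = fst (decomp q tau z) + snd (decomp q tau z) * tau"
    and "z ^ q = fst (decomp q tau z) + snd (decomp q tau z) * tau ^ q"
    using P conj[OF P] by simp_all
qed

section \<open>The two quadrics restricted to the hyperplane at infinity\<close>

lemma bbm_frob: "bbm (t :: 'a) i k ^ (q ^ m) = bbm (t ^ (q ^ m)) i k"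
  by (simp add: bbm_def power_0_left)

lemma bbcoef_frob:
  "bbcoef (t :: 'a) c k l ^ (q ^ m) = bbcoef (t ^ (q ^ m)) (\<lambda>i j. c i j ^ (q ^ m)) k l"
  by (cases "k = l") (simp_all add: bbcoef_def frob_sum power_mult_distrib frob_add bbm_frob)

lemma Q3_frob:
  "Q3 c (pt3 (x :: 'a) y) ^ (q ^ m) = Q3 (\<lambda>i j. c i j ^ (q ^ m)) (pt3 (x ^ (q ^ m)) (y ^ (q ^ m)))"
  by (simp add: Q3_pt3 frob_add power_mult_distrib mult.commute[of 2] flip: power_mult)

text \<open>The \<open>q ^ 3\<close>-th powers in the second condition allow the same form
  \<open>Q3 c\<close> in both: g'(X', Y') is the \<open>q\<close>-th power of its value at
  them.\<close>

lemma bbO_at_infinity: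
  assumes c: "\<forall>i<3. \<forall>j<3. c i j \<in> subF (q ^ 2)"
  shows "bbO r q tau c \<inter> Sigma_inf r = {v \<in> Sigma_inf r.
    Q3 c (pt3 (aff_x tau v) (aff_y tau v)) = 0 \<and>
    Q3 c (pt3 (aff_x (tau ^ q) v ^ (q ^ 3)) (aff_y (tau ^ q) v ^ (q ^ 3))) = 0}"
proof -
  have bbcoef_in: "bbcoef tau c k l \<in> subF (q ^ 2)" for k l
  proof -
    have "bbcoef tau c k l ^ (q ^ 2) = bbcoef tau (\<lambda>i j. c i j ^ (q ^ 2)) k l"
      using tau_in by (simp add: bbcoef_frob subF_iff)
    also have "\<dots> = bbcoef tau c k l"
      unfolding bbcoef_def using c by (intro sum.cong refl) (auto simp: subF_iff)
    finally show ?thesis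
      by (simp add: subF_iff)
  qed
  have iff: "f_inf q tau c v = 0 \<and> f_0 q tau c v = 0 \<longleftrightarrow>
    Q3 c (pt3 (aff_x tau v) (aff_y tau v)) = 0 \<and>
    Q3 c (pt3 (aff_x (tau ^ q) v ^ (q ^ 3)) (aff_y (tau ^ q) v ^ (q ^ 3))) = 0"
    (is "_ \<longleftrightarrow> ?A = 0 \<and> ?B = 0") if v4: "v 4 = 0" for v
  proof -
    \<comment> \<open>At \<open>t = tau\<close> the coefficients on the right are those of the
      substituted conic, at \<open>t = tau ^ q\<close> their \<open>q\<close>-th powers.\<close>
    have combine: "f_inf q tau c v + f_0 q tau c v * t = (\<Sum>k<5. \<Sum>l\<in>{k..<5}.
        (fst (decomp q tau (bbcoef tau c k l)) + snd (decomp q tau (bbcoef tau c k l)) * t) * v k * v l)" for t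
      by (simp add: f_inf_def f_0_def sum_distrib_left sum_distrib_right sum.distrib algebra_simps)
    have "f_inf q tau c v + f_0 q tau c v * tau = ?A"
      unfolding combine decomp_spec(1)[OF bbcoef_in, symmetric] aff_x_def aff_y_def
      by (rule sum_bbcoef_at_infinity[of v, OF v4])
    moreover have "f_inf q tau c v + f_0 q tau c v * tau ^ q = ?B ^ q"
    proof -
      have "f_inf q tau c v + f_0 q tau c v * tau ^ q
          = (\<Sum>k<5. \<Sum>l\<in>{k..<5}. bbcoef (tau ^ q) (\<lambda>i j. c i j ^ q) k l * v k * v l)"
        unfolding combine decomp_spec(2)[OF bbcoef_in, symmetric]
        using bbcoef_frob[of tau c _ _ 1] by simp
      also have "\<dots> = Q3 (\<lambda>i j. c i j ^ q) (pt3 (aff_x (tau ^ q) v) (aff_y (tau ^ q) v))"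
        unfolding aff_x_def aff_y_def by (rule sum_bbcoef_at_infinity[of v, OF v4])
      also have "\<dots> = ?B ^ q"
        using Q3_frob[of c "aff_x (tau ^ q) v ^ (q ^ 3)" "aff_y (tau ^ q) v ^ (q ^ 3)" 1]
        by (simp add: frob_3_q)
      finally show ?thesis .
    qed
    moreover have "f_inf q tau c v = 0 \<and> f_0 q tau c v = 0 \<longleftrightarrow>
        f_inf q tau c v + f_0 q tau c v * tau = 0 \<and> f_inf q tau c v + f_0 q tau c v * tau ^ q = 0"
      using tau_coords_unique[of "f_inf q tau c v" "f_0 q tau c v" 0 0] by auto
    ultimately show ?thesis
      by simp
  qed
  show ?thesis
    unfolding bbO_def using iff by (auto simp: Sigma_inf_def)
qed

section \<open>Lines at infinity described by proportionality conditions\<close>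

text \<open>
  The second condition says that \<open>(X', Y')\<close> is proportional to \<open>(s\<^sub>1\<^sup>q, s\<^sub>2\<^sup>q)\<close>: raising to the power \<open>q\<^sup>3\<close>
  inverts the Frobenius map.
\<close>
definition cell :: "nat \<Rightarrow> 'a \<Rightarrow> 'a \<Rightarrow> 'a \<Rightarrow> 'a \<Rightarrow> (nat \<Rightarrow> 'a) set" where
  "cell r p1 p2 s1 s2 = {v \<in> Sigma_inf r.
     aff_x tau v * p2 = aff_y tau v * p1 \<and>
     aff_x (tau ^ q) v ^ (q ^ 3) * s2 = aff_y (tau ^ q) v ^ (q ^ 3) * s1}"

text \<open>The pair \<open>(tau ^ q, -1)\<close> takes the value \<open>tau ^ q - tau\<close> at
  \<open>tau\<close> and 0 at \<open>tau ^ q\<close>; for \<open>(tau, -1)\<close> the roles are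
  exchanged. Hence \<open>m\<close> and \<open>n\<close> are the components along the two
  transversals.\<close>

lemma transversal_coords:
  assumes "a + b * tau = m * (tau ^ q - tau)" "a + b * tau ^ q = n * (tau - tau ^ q)"
  shows "a = m * tau ^ q + n * tau \<and> b = - m - n"
  by (rule tau_coords_unique) (simp_all add: assms algebra_simps)

lemma embP_apply:
  "embP q tau x y i = (if i = 0 then x * tau ^ q else if i = 1 then - x
     else if i = 2 then y * tau ^ q else if i = 3 then - y else 0)"
  by (simp add: embP_def A0_def A1_def)

text \<open>X' and Y' vanish at the first spanning point, X and Y at the second, so the two
  conditions of a cell constrain the two components separately. The field of definition
  \<open>r\<close> enters only through \<open>vecs r\<close>.\<close>

lemma line_pts_embP_frobv:
  assumes p: "(p1, p2) \<noteq> (0, 0)" and s: "(s1, s2) \<noteq> (0, 0)"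
  shows "line_pts r (embP q tau p1 p2) (frobv q (embP q tau s1 s2)) = cell r p1 p2 s1 s2"
    (is "line_pts r ?P ?S = _")
proof -
  note P = embP_apply[of p1 p2]
  have S: "?S i = (if i = 0 then s1 ^ q * tau else if i = 1 then - (s1 ^ q)
      else if i = 2 then s2 ^ q * tau else if i = 3 then - (s2 ^ q) else 0)" for i
    by (simp add: embP_apply frobv_def power_mult_distrib tau_q_q frob_minus_q)
  show ?thesis
  proof (intro equalityI subsetI)
    fix v assume "v \<in> line_pts r ?P ?S"
    then obtain a b where v: "v \<in> vecs r" "v = (\<lambda>i. a * ?P i + b * ?S i)"
      by (auto simp: line_pts_def sp2_def)
    have "aff_x tau v = a * (tau ^ q - tau) * p1" "aff_y tau v = a * (tau ^ q - tau) * p2"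
      "aff_x (tau ^ q) v = b * (tau - tau ^ q) * s1 ^ q" "aff_y (tau ^ q) v = b * (tau - tau ^ q) * s2 ^ q"
      by (simp_all add: aff_x_def aff_y_def v(2) P S algebra_simps)
    then show "v \<in> cell r p1 p2 s1 s2"
      using v(1) by (simp add: cell_def Sigma_inf_def power_mult_distrib frob_q_3) (simp add: v(2) P S)
  next
    fix v assume v: "v \<in> cell r p1 p2 s1 s2"
    obtain a where a: "aff_x tau v = a * p1" "aff_y tau v = a * p2"
      using proportional_imp_multiple[OF _ p] v unfolding cell_def by blast
    obtain b where "aff_x (tau ^ q) v ^ (q ^ 3) = b * s1" "aff_y (tau ^ q) v ^ (q ^ 3) = b * s2"
      using proportional_imp_multiple[OF _ s] v unfolding cell_def by blast
    then have b: "aff_x (tau ^ q) v = b ^ q * s1 ^ q" "aff_y (tau ^ q) v = b ^ q * s2 ^ q"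
      by (metis frob_3_q power_mult_distrib)+
    \<comment> \<open>Divides out the values of the transversal pairs at \<open>tau\<close> and
      \<open>tau ^ q\<close>.\<close>
    define m n where "m = a / (tau ^ q - tau)" and "n = b ^ q / (tau - tau ^ q)"
    have mn: "a = m * (tau ^ q - tau)" "b ^ q = n * (tau - tau ^ q)"
      using tau_neq by (auto simp: m_def n_def)
    have "v 0 = m * p1 * tau ^ q + n * s1 ^ q * tau \<and> v 1 = - (m * p1) - n * s1 ^ q"
      by (rule transversal_coords) (use a b mn in \<open>auto simp: aff_x_def algebra_simps\<close>)
    moreover have "v 2 = m * p2 * tau ^ q + n * s2 ^ q * tau \<and> v 3 = - (m * p2) - n * s2 ^ q"
      by (rule transversal_coords) (use a b mn in \<open>auto simp: aff_y_def algebra_simps\<close>)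
    moreover have "v i = 0" if "i \<noteq> 0" "i \<noteq> 1" "i \<noteq> 2" "i \<noteq> 3" for i
      using v that by (cases "i = 4") (auto simp: cell_def Sigma_inf_def vecs_def)
    ultimately have "v = (\<lambda>i. m * ?P i + n * ?S i)"
      by (auto simp: P S fun_eq_iff)
    then show "v \<in> line_pts r ?P ?S"
      using v by (auto simp: line_pts_def sp2_def cell_def Sigma_inf_def)
  qed
qed

text \<open>For either root \<open>t\<close> of the minimal polynomial, a vector of the span has
  y-part \<open>a + b * t\<close> and x-part \<open>(a + b * t) * (d0 + d1 * t)\<close>, so X is
  \<open>\<delta>\<close> times Y and X' is \<open>\<delta> ^ q\<close> times Y'. The point at
  \<open>p2 = 0\<close> is handled separately.\<close>

lemma spread_line_eq_cell:
  assumes F: "p1 \<in> subF (q ^ 2)" "p2 \<in> subF (q ^ 2)" and p: "(p1, p2) \<noteq> (0, 0)"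
  shows "spread_line r q tau t0 t1 p1 p2 = cell r p1 p2 p1 p2"
proof (cases "p2 = 0")
  case True
  then have "p1 \<noteq> 0"
    using p by simp
  have "aff_y tau v = 0 \<and> aff_y (tau ^ q) v = 0 \<longleftrightarrow> v 2 = 0 \<and> v 3 = 0" for v
    using tau_coords_unique[of "v 2" "v 3" 0 0] by (auto simp: aff_y_def)
  then have cell: "cell r p1 p2 p1 p2 = {v \<in> Sigma_inf r. v 2 = 0 \<and> v 3 = 0}"
    using True \<open>p1 \<noteq> 0\<close> by (auto simp: cell_def)
  have "v = (\<lambda>i. v 0 * (if i = 0 then 1 else 0) + v 1 * (if i = 1 then 1 else 0))"
    if "v \<in> Sigma_inf r" "v 2 = 0" "v 3 = 0" for v :: "nat \<Rightarrow> 'a"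
  proof
    fix i :: nat
    consider "i = 0" | "i = 1" | "i = 2" | "i = 3" | "i = 4" | "i \<ge> 5"
      by linarith
    then show "v i = v 0 * (if i = 0 then 1 else 0) + v 1 * (if i = 1 then 1 else 0)"
      using that by cases (auto simp: Sigma_inf_def vecs_def)
  qed
  then show ?thesis
    unfolding cell using True
    by (auto simp: spread_line_def spread_gens_def line_pts_def sp2_def Sigma_inf_def)
next
  case False
  define \<delta> where "\<delta> = p1 / p2"
  have "\<delta> \<in> subF (q ^ 2)"
    using F by (simp add: \<delta>_def subF_closed)
  obtain d0 d1 where d: "decomp q tau \<delta> = (d0, d1)"
    by fastforce
  have \<delta>: "\<delta> = d0 + d1 * tau" "\<delta> ^ q = d0 + d1 * tau ^ q"
    using decomp_spec[OF \<open>\<delta> \<in> subF (q ^ 2)\<close>] d by simp_all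
  define g :: "nat \<Rightarrow> 'a" where
    "g = (\<lambda>i. if i = 0 then d0 else if i = 1 then d1 else if i = 2 then 1 else 0)"
  define h :: "nat \<Rightarrow> 'a" where
    "h = (\<lambda>i. if i = 0 then t0 * d1 else if i = 1 then d0 + t1 * d1 else if i = 3 then 1 else 0)"
  have line: "spread_line r q tau t0 t1 p1 p2 = line_pts r g h"
    using False d by (simp add: spread_line_def spread_gens_def \<delta>_def g_def h_def)
  have cell_iff: "v \<in> cell r p1 p2 p1 p2 \<longleftrightarrow> v \<in> Sigma_inf r \<and>
      aff_x tau v = aff_y tau v * \<delta> \<and> aff_x (tau ^ q) v = aff_y (tau ^ q) v * \<delta> ^ q" for v
  proof -
    have "x * p2 = y * p1 \<longleftrightarrow> x = y * \<delta>" for x y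
      using False by (auto simp: \<delta>_def field_simps)
    moreover have "x ^ (q ^ 3) = y ^ (q ^ 3) * \<delta> \<longleftrightarrow> x = y * \<delta> ^ q" for x y
      by (metis frob_3_q frob_q_3 power_mult_distrib)
    ultimately show ?thesis
      by (simp add: cell_def)
  qed
  have span: "aff_x t (\<lambda>i. a * g i + b * h i) = (a + b * t) * (d0 + d1 * t)"
    if "t ^ 2 = t1 * t + t0" for a b t
  proof -
    have "(a + b * t) * (d0 + d1 * t) = a * d0 + (a * d1 + b * d0) * t + b * d1 * t ^ 2"
      by (simp add: power2_eq_square algebra_simps)
    then show ?thesis
      by (simp add: that aff_x_def g_def h_def algebra_simps)
  qed
  note spans = span[OF minpoly] span[OF minpoly_conj]
  show ?thesis
    unfolding line
  proof (intro equalityI subsetI)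
    fix v assume "v \<in> line_pts r g h"
    then obtain a b where v: "v \<in> vecs r" "v = (\<lambda>i. a * g i + b * h i)"
      by (auto simp: line_pts_def sp2_def)
    have "aff_y t v = a + b * t" for t
      by (simp add: v(2) aff_y_def g_def h_def)
    moreover have "v 4 = 0"
      by (simp add: v(2) g_def h_def)
    ultimately show "v \<in> cell r p1 p2 p1 p2"
      unfolding cell_iff \<delta>(2) unfolding \<delta>(1)
      using v(1) spans[of a b] by (simp add: Sigma_inf_def flip: v(2))
  next
    fix v assume "v \<in> cell r p1 p2 p1 p2"
    then have v: "v \<in> Sigma_inf r" "aff_x tau v = aff_y tau v * \<delta>"
      "aff_x (tau ^ q) v = aff_y (tau ^ q) v * \<delta> ^ q"
      by (simp_all add: cell_iff)
    \<comment> \<open>The entries of \<open>g\<close> and \<open>h\<close> at positions 2 and 3 form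
      the identity matrix, so \<open>v 2\<close> and \<open>v 3\<close> are the only possible
      coefficients.\<close>
    define w where "w = (\<lambda>i. v 2 * g i + v 3 * h i)"
    have "aff_x tau v = aff_x tau w" "aff_x (tau ^ q) v = aff_x (tau ^ q) w"
      unfolding v(2,3) \<delta>(2) unfolding \<delta>(1) w_def spans aff_y_def by (rule refl)+
    then have "v 0 = w 0 \<and> v 1 = w 1"
      by (intro tau_coords_unique) (simp_all only: aff_x_def)
    moreover have "v i = w i" if i: "i \<noteq> 0" "i \<noteq> 1" for i
    proof -
      consider "i = 2" | "i = 3" | "i = 4" | "i \<ge> 5"
        using i by linarith
      then show ?thesis
        using v(1) by cases (auto simp: w_def g_def h_def Sigma_inf_def vecs_def)
    qed
    ultimately have "v = w"
      by (metis ext)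
    then show "v \<in> line_pts r g h"
      using v(1) by (auto simp: line_pts_def sp2_def Sigma_inf_def w_def)
  qed
qed

section \<open>Rationality over the smaller fields and double roots\<close>

lemma Sigma_inf_coords_not_all_zero:
  assumes "v \<in> Sigma_inf r" "aff_x tau v = 0" "aff_y tau v = 0"
    "aff_x (tau ^ q) v = 0" "aff_y (tau ^ q) v = 0"
  shows False
proof -
  have "v 0 = 0 \<and> v 1 = 0" "v 2 = 0 \<and> v 3 = 0"
    using tau_coords_unique[of "v 0" "v 1" 0 0] tau_coords_unique[of "v 2" "v 3" 0 0] assms
    by (auto simp: aff_x_def aff_y_def)
  moreover have "v i = 0" if "i \<noteq> 0" "i \<noteq> 1" "i \<noteq> 2" "i \<noteq> 3" for i
    using assms(1) that by (cases "i = 4") (auto simp: Sigma_inf_def vecs_def)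
  ultimately have "v = (\<lambda>_. 0)"
    by metis
  then show False
    using assms(1) by (simp add: Sigma_inf_def vecs_def)
qed

text \<open>For coordinates in F_q, X' and Y' are the \<open>q\<close>-th powers of X and Y, so (X,
  Y) is proportional to two independent vectors and vanishes.\<close>

lemma cell_q_eq_empty:
  assumes "p1 * s2 \<noteq> p2 * s1"
  shows "cell q p1 p2 s1 s2 = {}"
proof (rule equals0I)
  fix v assume v: "v \<in> cell q p1 p2 s1 s2"
  then have "v i ^ q = v i" for i
    by (simp add: cell_def Sigma_inf_def vecs_def subF_iff)
  then have "v i ^ (q ^ 3) = v i" for i
    by (metis frob_q_3)
  then have conj: "aff_x (tau ^ q) v ^ (q ^ 3) = aff_x tau v" "aff_y (tau ^ q) v ^ (q ^ 3) = aff_y tau v"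
    by (simp_all add: aff_x_def aff_y_def frob_add power_mult_distrib tau_q_3)
  have "aff_x tau v = 0 \<and> aff_y tau v = 0"
    using v assms by (intro proportional_to_both_imp_zero[of _ p2 _ p1 s2 s1]) (simp_all add: cell_def conj)
  moreover from this have "aff_x (tau ^ q) v = 0 \<and> aff_y (tau ^ q) v = 0"
    using conj by simp
  ultimately show False
    using v Sigma_inf_coords_not_all_zero by (auto simp: cell_def)
qed

text \<open>Uniqueness is assumed over F_{q^2}, the conclusion is for all \<open>x\<close>,
  \<open>y\<close>. Splitting off the known root leaves a linear cofactor over F_{q^2}; its root
  lies in that field, hence is the same one, and the form is a nonzero multiple of a square.\<close>

lemma binary_form_double_root:
  fixes c :: "nat \<Rightarrow> nat \<Rightarrow> 'a"
  assumes c: "\<forall>i<3. \<forall>j<3. c i j \<in> subF (q ^ 2)"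
    and F: "p1 \<in> subF (q ^ 2)" "p2 \<in> subF (q ^ 2)" and p: "(p1, p2) \<noteq> (0, 0)"
    and root: "Q3 c (pt3 p1 p2) = 0"
    and unique: "\<And>x y. x \<in> subF (q ^ 2) \<Longrightarrow> y \<in> subF (q ^ 2) \<Longrightarrow> (x, y) \<noteq> (0, 0) \<Longrightarrow>
      Q3 c (pt3 x y) = 0 \<Longrightarrow> x * p2 = y * p1"
  shows "Q3 c (pt3 x y) = 0 \<longleftrightarrow> x * p2 = y * p1"
proof -
  define a b d where "a = c 0 0" and "b = c 0 1" and "d = c 1 1"
  have abd: "a \<in> subF (q ^ 2)" "b \<in> subF (q ^ 2)" "d \<in> subF (q ^ 2)"
    using c by (simp_all add: a_def b_def d_def)
  have Q: "Q3 c (pt3 x y) = a * x ^ 2 + b * x * y + d * y ^ 2" for x y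
    by (simp add: Q3_pt3 a_def b_def d_def)
  show ?thesis
  proof (cases "p2 = 0")
    case True
    then have "p1 \<noteq> 0"
      using p by simp
    then have "a = 0"
      using root True by (simp add: Q)
    have "b = 0"
    proof (rule ccontr)
      assume "b \<noteq> 0"
      \<comment> \<open>With \<open>a = 0\<close> the form is \<open>y * (b * x + d * y)\<close>,
        and \<open>(d, - b)\<close> is a root of the second factor.\<close>
      have "Q3 c (pt3 d (- b)) = 0"
        using \<open>a = 0\<close> by (simp add: Q power2_eq_square)
      then have "d * p2 = - b * p1"
        using abd \<open>b \<noteq> 0\<close> by (intro unique) (simp_all add: subF_closed subF_minus)
      then show False
        using True \<open>p1 \<noteq> 0\<close> \<open>b \<noteq> 0\<close> by simp
    qed
    moreover have "d \<noteq> 0"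
    proof
      assume "d = 0"
      then have "0 * p2 = 1 * p1"
        by (intro unique) (simp_all add: zero_one_in_subF Q)
      then show False
        using \<open>p1 \<noteq> 0\<close> by simp
    qed
    ultimately show ?thesis
      using True \<open>p1 \<noteq> 0\<close> \<open>a = 0\<close> by (simp add: Q)
  next
    case False
    define e where "e = a * p1 + b * p2"
    have fac: "p2 ^ 2 * Q3 c (pt3 x y) = (x * p2 - y * p1) * (a * p2 * x + e * y)" for x y
    proof -
      have "p2 ^ 2 * Q3 c (pt3 x y) = (x * p2 - y * p1) * (a * p2 * x + e * y) + y ^ 2 * Q3 c (pt3 p1 p2)"
        by (simp add: Q e_def power2_eq_square algebra_simps)
      with root show ?thesis
        by simp
    qed
    have "\<not> (a = 0 \<and> b = 0)"
    proof
      assume ab: "a = 0 \<and> b = 0"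
      then have "p2 ^ 2 * Q3 c (pt3 1 0) = 0"
        by (simp add: fac e_def)
      then have "1 * p2 = 0 * p1"
        using False by (intro unique) (simp_all add: zero_one_in_subF)
      then show False
        using False by simp
    qed
    have "- e * p2 = a * p2 * p1"
    \<comment> \<open>\<open>(- e, a * p2)\<close> is a root of the cofactor
      \<open>a * p2 * x + e * y\<close>; if both entries are 0 the claim is trivial.\<close>
    proof (cases "(- e, a * p2) = (0, 0)")
      case False
      have "p2 ^ 2 * Q3 c (pt3 (- e) (a * p2)) = 0"
        by (simp add: fac)
      then show ?thesis
        using False \<open>p2 \<noteq> 0\<close> abd F by (intro unique) (simp_all add: subF_closed subF_minus e_def)
    qed simp
    then have e: "e * p2 = - (a * p2 * p1)"
      by (metis minus_minus mult_minus_left)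
    then have "a \<noteq> 0"
      using False \<open>\<not> (a = 0 \<and> b = 0)\<close> by (auto simp: e_def)
    have "p2 * (p2 ^ 2 * Q3 c (pt3 x y)) = (x * p2 - y * p1) * (a * p2 * p2 * x + e * p2 * y)"
      unfolding fac by (simp add: algebra_simps)
    also have "\<dots> = a * p2 * (x * p2 - y * p1) ^ 2"
      unfolding e by (simp add: power2_eq_square algebra_simps)
    finally show ?thesis
      using False \<open>a \<noteq> 0\<close> by (metis eq_iff_diff_eq_0 mult_eq_0_iff power2_eq_square)
  qed
qed

section \<open>The secant, tangent and external cases\<close>

text \<open>Each of the two conditions at infinity is a choice between two roots, giving four cells.
  Taking equal roots yields the tangent case.\<close>

lemma bbO_secant:
  assumes c: "\<forall>i<3. \<forall>j<3. c i j \<in> subF (q ^ 2)"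
    and roots: "\<And>x y. Q3 c (pt3 x y) = 0 \<longleftrightarrow> x * p2 = y * p1 \<or> x * s2 = y * s1"
  shows "bbO r q tau c \<inter> Sigma_inf r
    = cell r p1 p2 p1 p2 \<union> cell r s1 s2 s1 s2 \<union> cell r p1 p2 s1 s2 \<union> cell r s1 s2 p1 p2"
  unfolding bbO_at_infinity[OF c] roots cell_def by blast

text \<open>Over F_{q^2} all of X, Y, X', Y' lie in that field, so the absence of roots there forces
  them to vanish.\<close>

lemma bbO_external_eq_empty:
  assumes c: "\<forall>i<3. \<forall>j<3. c i j \<in> subF (q ^ 2)"
    and no_root: "\<And>x y. x \<in> subF (q ^ 2) \<Longrightarrow> y \<in> subF (q ^ 2) \<Longrightarrow> (x, y) \<noteq> (0, 0) \<Longrightarrow>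
      Q3 c (pt3 x y) \<noteq> 0"
  shows "bbO (q ^ 2) q tau c \<inter> Sigma_inf (q ^ 2) = {}"
proof (rule equals0I)
  fix v assume "v \<in> bbO (q ^ 2) q tau c \<inter> Sigma_inf (q ^ 2)"
  then have v: "v \<in> Sigma_inf (q ^ 2)" "Q3 c (pt3 (aff_x tau v) (aff_y tau v)) = 0"
    "Q3 c (pt3 (aff_x (tau ^ q) v ^ (q ^ 3)) (aff_y (tau ^ q) v ^ (q ^ 3))) = 0"
    unfolding bbO_at_infinity[OF c] by simp_all
  have "v i \<in> subF (q ^ 2)" for i
    using v(1) by (simp add: Sigma_inf_def vecs_def)
  then have "aff_x t v \<in> subF (q ^ 2)" "aff_y t v \<in> subF (q ^ 2)" if "t \<in> subF (q ^ 2)" for t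
    using that by (simp_all add: aff_x_def aff_y_def subF_closed)
  then have "aff_x tau v = 0 \<and> aff_y tau v = 0"
    "aff_x (tau ^ q) v ^ (q ^ 3) = 0 \<and> aff_y (tau ^ q) v ^ (q ^ 3) = 0"
    using no_root v(2,3) tau_in tau_q_in subF_power by (metis prod.inject)+
  then show False
    using Sigma_inf_coords_not_all_zero[OF v(1)] by simp
qed

lemma bbO_q_subset: "bbO q q tau c \<inter> Sigma_inf q \<subseteq> bbO (q ^ 2) q tau c \<inter> Sigma_inf (q ^ 2)"
proof -
  have "subF q \<subseteq> (subF (q ^ 2) :: 'a set)"
    by (auto simp: subF_def power2_eq_square power_mult)
  then have "vecs q \<subseteq> (vecs (q ^ 2) :: (nat \<Rightarrow> 'a) set)"
    by (auto simp: vecs_def)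
  then show ?thesis
    by (auto simp: bbO_def Sigma_inf_def)
qed

text \<open>Dividing by \<open>c 0 0\<close> gives a monic quadratic over F_{q^2}, and the whole
  field is the quadratic extension of that field.\<close>

lemma Q3_has_root_at_infinity:
  fixes c :: "nat \<Rightarrow> nat \<Rightarrow> 'a"
  assumes c: "\<forall>i<3. \<forall>j<3. c i j \<in> subF (q ^ 2)" and c00: "c 0 0 \<noteq> 0"
  shows "\<exists>x. Q3 c (pt3 x 1) = 0"
proof -
  obtain p k where p: "prime p" "q = p ^ k"
    using q_prime_power by blast
  have "c 0 0 \<in> subF (q ^ 2)" "c 0 1 \<in> subF (q ^ 2)" "c 1 1 \<in> subF (q ^ 2)"
    using c by simp_all
  then have "c 0 1 / c 0 0 \<in> subF (q ^ 2)" "c 1 1 / c 0 0 \<in> subF (q ^ 2)"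
    by (simp_all only: subF_closed)
  then have "\<exists>x. x ^ 2 + c 0 1 / c 0 0 * x + c 1 1 / c 0 0 = 0"
    by (intro quadratic_has_root[OF p(1), where n = "k * 2" and r = "q ^ 2"])
      (simp_all add: p(2) subF_iff card_UNIV power_mult)
  then obtain x where "x ^ 2 + c 0 1 / c 0 0 * x + c 1 1 / c 0 0 = 0"
    by blast
  then have "c 0 0 * (x ^ 2 + c 0 1 / c 0 0 * x + c 1 1 / c 0 0) = 0"
    by simp
  then show ?thesis
    using c00 by (auto simp: Q3_pt3 distrib_left)
qed

text \<open>\<open>A0\<close> and \<open>A1\<close> have coordinates in F_{q^2}, so this power only
  moves the parameters.\<close>

lemma frobv_embP_2: "frobv (q ^ 2) (embP q tau p1 p2) = embP q tau (p1 ^ (q ^ 2)) (p2 ^ (q ^ 2))"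
  using tau_q_in by (simp add: frobv_def embP_apply fun_eq_iff power_mult_distrib frob_minus subF_iff)

lemma frobv_frobv: "frobv (q ^ n) (frobv (q ^ m) v) = frobv (q ^ (m + n)) (v :: nat \<Rightarrow> 'a)"
  by (simp add: frobv_def frob_frob)

text \<open>The second root is the \<open>q ^ 2\<close>-conjugate of the first, distinct from it
  since otherwise \<open>p1 / p2\<close> would give a root over F_{q^2}. Its image is
  \<open>frobv (q ^ 2) P\<close>, so the four lines join consecutive conjugates of
  \<open>P\<close>.\<close>

lemma bbO_external:
  assumes c: "\<forall>i<3. \<forall>j<3. c i j \<in> subF (q ^ 2)"
    and no_root: "\<And>x y. x \<in> subF (q ^ 2) \<Longrightarrow> y \<in> subF (q ^ 2) \<Longrightarrow> (x, y) \<noteq> (0, 0) \<Longrightarrow>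
      Q3 c (pt3 x y) \<noteq> 0"
    and p: "(p1, p2) \<noteq> (0, 0)" and root: "Q3 c (pt3 p1 p2) = 0"
  defines "P \<equiv> embP q tau p1 p2"
  shows "bbO r q tau c \<inter> Sigma_inf r
    = (\<Union>k<4. line_pts r (frobv (q ^ k) P) (frobv (q ^ Suc k) P))"
proof -
  define s1 s2 where "s1 = p1 ^ (q ^ 2)" and "s2 = p2 ^ (q ^ 2)"
  have s: "(s1, s2) \<noteq> (0, 0)"
    using p by (simp add: s1_def s2_def)
  have "p2 \<noteq> 0"
  proof
    assume "p2 = 0"
    then have "Q3 c (pt3 1 0) = 0"
      using root p by (simp add: Q3_pt3)
    then show False
      using no_root[of 1 0] by (simp add: zero_one_in_subF)
  qed
  have "p1 * s2 \<noteq> p2 * s1"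
  proof
    assume "p1 * s2 = p2 * s1"
    then have "p1 / p2 \<in> subF (q ^ 2)"
      using \<open>p2 \<noteq> 0\<close> by (simp add: s1_def s2_def subF_iff field_simps)
    moreover have "p2 ^ 2 * Q3 c (pt3 (p1 / p2) 1) = Q3 c (pt3 p1 p2)"
      using \<open>p2 \<noteq> 0\<close> by (simp add: Q3_pt3 power2_eq_square field_simps)
    then have "Q3 c (pt3 (p1 / p2) 1) = 0"
      using root \<open>p2 \<noteq> 0\<close> by simp
    ultimately show False
      using no_root[of "p1 / p2" 1] by (simp add: zero_one_in_subF)
  qed
  moreover have "Q3 c (pt3 s1 s2) = 0"
  proof -
    have "Q3 (\<lambda>i j. c i j ^ (q ^ 2)) (pt3 s1 s2) = Q3 c (pt3 p1 p2) ^ (q ^ 2)"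
      by (simp add: Q3_frob s1_def s2_def)
    then show ?thesis
      using c root by (simp add: Q3_pt3 subF_iff)
  qed
  moreover have "Q3 c (pt3 1 0) \<noteq> 0"
    by (rule no_root) (simp_all add: zero_one_in_subF)
  ultimately have roots: "Q3 c (pt3 x y) = 0 \<longleftrightarrow> x * p2 = y * p1 \<or> x * s2 = y * s1" for x y
    using binary_form_split root by blast
  have P2: "frobv (q ^ 2) P = embP q tau s1 s2"
    by (simp add: P_def frobv_embP_2 s1_def s2_def)
  have P3: "frobv (q ^ 3) P = frobv q (embP q tau s1 s2)"
    using frobv_frobv[of 1 2 P] by (simp add: P2)
  have P4: "frobv (q ^ 4) P = P"
    by (simp add: frobv_def frob_4)
  have P0: "frobv (q ^ 0) P = P"
    by (simp add: frobv_def)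
  have "{..<4} = {0, 1, 2, 3 :: nat}"
    by auto
  then have "(\<Union>k<4. line_pts r (frobv (q ^ k) P) (frobv (q ^ Suc k) P))
      = line_pts r P (frobv q P) \<union> line_pts r (frobv q P) (embP q tau s1 s2)
        \<union> line_pts r (embP q tau s1 s2) (frobv q (embP q tau s1 s2))
        \<union> line_pts r (frobv q (embP q tau s1 s2)) P"
    using P0 P2 P3 P4 by (simp add: numeral_2_eq_2 numeral_3_eq_3 numeral_eq_Suc Un_assoc)
  also have "\<dots> = cell r p1 p2 p1 p2 \<union> cell r s1 s2 p1 p2 \<union> cell r s1 s2 s1 s2 \<union> cell r p1 p2 s1 s2"
    unfolding P_def line_pts_commute[of _ "frobv _ _"]
    by (simp only: line_pts_embP_frobv[OF p p] line_pts_embP_frobv[OF s p]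
        line_pts_embP_frobv[OF s s] line_pts_embP_frobv[OF p s])
  finally show ?thesis
    unfolding bbO_secant[OF c roots] by blast
qed

end

theorem theorem4p3:
  fixes q :: nat and tau t0 t1 :: "'a::{field,finite}" and c :: "nat \<Rightarrow> nat \<Rightarrow> 'a"
  assumes q_pp: "\<exists>p k. prime p \<and> k > 0 \<and> q = p ^ k"
    and cardK: "card (UNIV :: 'a set) = q ^ 4"
    and tau_F: "tau \<in> subF (q ^ 2)" "tau \<noteq> 0"
    and tau_prim: "\<forall>k. 0 < k \<and> k < q ^ 2 - 1 \<longrightarrow> tau ^ k \<noteq> 1"
    and t_F: "t0 \<in> subF q" "t1 \<in> subF q"
    and minpoly: "tau ^ 2 = t1 * tau + t0"
    and c_F: "\<forall>i<3. \<forall>j<3. c i j \<in> subF (q ^ 2)"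
    and nondeg: "nondeg_conic c"
  shows
   "(\<forall>p1 p2 q1 q2.
       p1 \<in> subF (q ^ 2) \<and> p2 \<in> subF (q ^ 2) \<and> q1 \<in> subF (q ^ 2) \<and> q2 \<in> subF (q ^ 2) \<and>
       (p1, p2) \<noteq> (0, 0) \<and> (q1, q2) \<noteq> (0, 0) \<and> p1 * q2 \<noteq> p2 * q1 \<and>
       Q3 c (pt3 p1 p2) = 0 \<and> Q3 c (pt3 q1 q2) = 0 \<and>
       (\<forall>x y. x \<in> subF (q ^ 2) \<and> y \<in> subF (q ^ 2) \<and> (x, y) \<noteq> (0, 0) \<and> Q3 c (pt3 x y) = 0
              \<longrightarrow> x * p2 = y * p1 \<or> x * q2 = y * q1)
     \<longrightarrow> (let P = embP q tau p1 p2; Q = embP q tau q1 q2 in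
          bbO q q tau c \<inter> Sigma_inf q
            = spread_line q q tau t0 t1 p1 p2 \<union> spread_line q q tau t0 t1 q1 q2 \<and>
          bbO (q ^ 2) q tau c \<inter> Sigma_inf (q ^ 2)
            = spread_line (q ^ 2) q tau t0 t1 p1 p2 \<union> spread_line (q ^ 2) q tau t0 t1 q1 q2
              \<union> line_pts (q ^ 2) P (frobv q Q) \<union> line_pts (q ^ 2) (frobv q P) Q \<and>
          bbO (q ^ 4) q tau c \<inter> Sigma_inf (q ^ 4)
            = spread_line (q ^ 4) q tau t0 t1 p1 p2 \<union> spread_line (q ^ 4) q tau t0 t1 q1 q2
              \<union> line_pts (q ^ 4) P (frobv q Q) \<union> line_pts (q ^ 4) (frobv q P) Q)) \<and>
    (\<forall>p1 p2.
       p1 \<in> subF (q ^ 2) \<and> p2 \<in> subF (q ^ 2) \<and> (p1, p2) \<noteq> (0, 0) \<and> Q3 c (pt3 p1 p2) = 0 \<and>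
       (\<forall>x y. x \<in> subF (q ^ 2) \<and> y \<in> subF (q ^ 2) \<and> (x, y) \<noteq> (0, 0) \<and> Q3 c (pt3 x y) = 0
              \<longrightarrow> x * p2 = y * p1)
     \<longrightarrow> bbO q q tau c \<inter> Sigma_inf q = spread_line q q tau t0 t1 p1 p2 \<and>
         bbO (q ^ 2) q tau c \<inter> Sigma_inf (q ^ 2) = spread_line (q ^ 2) q tau t0 t1 p1 p2 \<and>
         bbO (q ^ 4) q tau c \<inter> Sigma_inf (q ^ 4) = spread_line (q ^ 4) q tau t0 t1 p1 p2) \<and>
    ((\<forall>x y. x \<in> subF (q ^ 2) \<and> y \<in> subF (q ^ 2) \<and> (x, y) \<noteq> (0, 0) \<longrightarrow> Q3 c (pt3 x y) \<noteq> 0)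
     \<longrightarrow> bbO q q tau c \<inter> Sigma_inf q = {} \<and>
         bbO (q ^ 2) q tau c \<inter> Sigma_inf (q ^ 2) = {} \<and>
         (\<exists>p1 p2. (p1, p2) \<noteq> (0, 0) \<and> Q3 c (pt3 p1 p2) = 0) \<and>
         (\<forall>p1 p2. (p1, p2) \<noteq> (0, 0) \<and> Q3 c (pt3 p1 p2) = 0 \<longrightarrow>
            (let P = embP q tau p1 p2 in
              bbO (q ^ 4) q tau c \<inter> Sigma_inf (q ^ 4)
                = (\<Union>k<4. line_pts (q ^ 4) (frobv (q ^ k) P) (frobv (q ^ Suc k) P)))))"
proof -
  interpret bruck_bose q tau t0 t1
    by unfold_locales (use assms in blast)+
  show ?thesis
  proof (intro conjI allI impI; (elim conjE)?)
    fix p1 p2 q1 q2 :: 'a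
    assume p: "p1 \<in> subF (q ^ 2)" "p2 \<in> subF (q ^ 2)" "(p1, p2) \<noteq> (0, 0)" "Q3 c (pt3 p1 p2) = 0"
      and s: "q1 \<in> subF (q ^ 2)" "q2 \<in> subF (q ^ 2)" "(q1, q2) \<noteq> (0, 0)" "Q3 c (pt3 q1 q2) = 0"
      and ps: "p1 * q2 \<noteq> p2 * q1"
      and only: "\<forall>x y. x \<in> subF (q ^ 2) \<and> y \<in> subF (q ^ 2) \<and> (x, y) \<noteq> (0, 0) \<and> Q3 c (pt3 x y) = 0
              \<longrightarrow> x * p2 = y * p1 \<or> x * q2 = y * q1"
    \<comment> \<open>A sum of two independent roots is proportional to neither, hence not a root;
      this excludes the zero form.\<close>
    have nz: "Q3 c (pt3 (p1 + q1) (p2 + q2)) \<noteq> 0"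
    proof
      assume "Q3 c (pt3 (p1 + q1) (p2 + q2)) = 0"
      moreover have "(p1 + q1) * p2 \<noteq> (p2 + q2) * p1" "(p1 + q1) * q2 \<noteq> (p2 + q2) * q1"
        using ps by (simp_all add: algebra_simps)
      moreover from this have "(p1 + q1, p2 + q2) \<noteq> (0, 0)"
        by auto
      ultimately show False
        using only p s by (metis subF_closed(1))
    qed
    note sec = bbO_secant[OF c_F binary_form_split[OF p(4) s(4) ps nz]]
    \<comment> \<open>Over F_q the two mixed lines carry no points, which leaves the spread lines
      alone.\<close>
    have "cell q p1 p2 q1 q2 = {}" "cell q q1 q2 p1 p2 = {}"
      using ps by (auto intro!: cell_q_eq_empty simp: mult.commute)
    then show "let P = embP q tau p1 p2; Q = embP q tau q1 q2 in
          bbO q q tau c \<inter> Sigma_inf q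
            = spread_line q q tau t0 t1 p1 p2 \<union> spread_line q q tau t0 t1 q1 q2 \<and>
          bbO (q ^ 2) q tau c \<inter> Sigma_inf (q ^ 2)
            = spread_line (q ^ 2) q tau t0 t1 p1 p2 \<union> spread_line (q ^ 2) q tau t0 t1 q1 q2
              \<union> line_pts (q ^ 2) P (frobv q Q) \<union> line_pts (q ^ 2) (frobv q P) Q \<and>
          bbO (q ^ 4) q tau c \<inter> Sigma_inf (q ^ 4)
            = spread_line (q ^ 4) q tau t0 t1 p1 p2 \<union> spread_line (q ^ 4) q tau t0 t1 q1 q2
              \<union> line_pts (q ^ 4) P (frobv q Q) \<union> line_pts (q ^ 4) (frobv q P) Q"
      unfolding Let_def sec spread_line_eq_cell[OF p(1-3)] spread_line_eq_cell[OF s(1-3)]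
        line_pts_commute[of _ "frobv _ _"] line_pts_embP_frobv[OF p(3) s(3)]
        line_pts_embP_frobv[OF s(3) p(3)]
      by simp
  next
    fix p1 p2 :: 'a
    assume p: "p1 \<in> subF (q ^ 2)" "p2 \<in> subF (q ^ 2)" "(p1, p2) \<noteq> (0, 0)" "Q3 c (pt3 p1 p2) = 0"
      and only: "\<forall>x y. x \<in> subF (q ^ 2) \<and> y \<in> subF (q ^ 2) \<and> (x, y) \<noteq> (0, 0) \<and> Q3 c (pt3 x y) = 0
              \<longrightarrow> x * p2 = y * p1"
    have "Q3 c (pt3 x y) = 0 \<longleftrightarrow> x * p2 = y * p1 \<or> x * p2 = y * p1" for x y
      using binary_form_double_root[OF c_F p, of x y] only by blast
    from bbO_secant[OF c_F this]
    have "bbO r q tau c \<inter> Sigma_inf r = spread_line r q tau t0 t1 p1 p2" for r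
      by (simp only: spread_line_eq_cell[OF p(1-3)] Un_absorb)
    then show "bbO q q tau c \<inter> Sigma_inf q = spread_line q q tau t0 t1 p1 p2"
      "bbO (q ^ 2) q tau c \<inter> Sigma_inf (q ^ 2) = spread_line (q ^ 2) q tau t0 t1 p1 p2"
      "bbO (q ^ 4) q tau c \<inter> Sigma_inf (q ^ 4) = spread_line (q ^ 4) q tau t0 t1 p1 p2"
      by blast+
  next
    assume "\<forall>x y. x \<in> subF (q ^ 2) \<and> y \<in> subF (q ^ 2) \<and> (x, y) \<noteq> (0, 0) \<longrightarrow> Q3 c (pt3 x y) \<noteq> 0"
    then have no_root: "\<And>x y. x \<in> subF (q ^ 2) \<Longrightarrow> y \<in> subF (q ^ 2) \<Longrightarrow> (x, y) \<noteq> (0, 0) \<Longrightarrow>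
        Q3 c (pt3 x y) \<noteq> 0"
      by blast
    show empty: "bbO (q ^ 2) q tau c \<inter> Sigma_inf (q ^ 2) = {}"
      by (rule bbO_external_eq_empty[OF c_F no_root])
    show "bbO q q tau c \<inter> Sigma_inf q = {}"
      using bbO_q_subset empty by blast
    have "Q3 c (pt3 1 0) \<noteq> 0"
      by (rule no_root) (simp_all add: zero_one_in_subF)
    then have "c 0 0 \<noteq> 0"
      by (simp add: Q3_pt3)
    then obtain x where "Q3 c (pt3 x 1) = 0"
      using Q3_has_root_at_infinity[OF c_F] by blast
    then show "\<exists>p1 p2. (p1, p2) \<noteq> (0, 0) \<and> Q3 c (pt3 p1 p2) = 0"
      by (intro exI[of _ x] exI[of _ 1]) simp
    show "let P = embP q tau p1 p2 in bbO (q ^ 4) q tau c \<inter> Sigma_inf (q ^ 4)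
        = (\<Union>k<4. line_pts (q ^ 4) (frobv (q ^ k) P) (frobv (q ^ Suc k) P))"
      if "(p1, p2) \<noteq> (0, 0)" "Q3 c (pt3 p1 p2) = 0" for p1 p2
      unfolding Let_def by (rule bbO_external[OF c_F no_root that])
  qed
qed

end
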